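(* For every integer $n\ge 1$, let $\operatorname{Reg}_n=\{a\in\mathbb{Z}: 1\le a\le n,\ \exists x\in\mathbb{Z} \text{ with } a^2x\equiv a \pmod n\}$, let $\varrho(n)=\#\operatorname{Reg}_n$, and let $S(n)=\sum_{a\in \operatorname{Reg}_n} a$. Then for every $n\ge 1$, \[ S(n)=\frac{n(\varrho(n)+1)}{2}. \]
   Context: An integer $a$ is called regular (mod $n$) if there is an integer $x$ with $a^2x\equiv a \pmod n$. $\varrho(n)$ is the number of regular integers (mod $n$) in $\{1,\dots,n\}$ and $S(n)$ is their sum. *)

theory Defs
  imports Complex_Main "HOL-Number_Theory.Cong"
begin

definition regular_mod :: "int \<Rightarrow> int \<Rightarrow> bool" where
  "regular_mod n a \<longleftrightarrow> (\<exists>x::int. [a\<^sup>2 * x = a] (mod n))"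

definition Reg :: "int \<Rightarrow> int set" where
  "Reg n = {a. 1 \<le> a \<and> a \<le> n \<and> regular_mod n a}"

definition varrho :: "int \<Rightarrow> nat" where
  "varrho n = card (Reg n)"

definition reg_sum :: "int \<Rightarrow> int" where
  "reg_sum n = (\<Sum>a\<in>Reg n. a)"

end

theory Submission
  imports Defs
begin

text \<open>Regularity is invariant under negation mod \<open>n\<close>
  (\<open>regular_mod_diff\<close>). Adding the sum over \<open>Reg n - {n}\<close> to its reflected
  copy gives \<open>n\<close> per element (\<open>sum_Reg_minus_self\<close>); the element
  \<open>n\<close> itself adds \<open>2 * n\<close> to the doubled sum.\<close>

text \<open>The residue \<open>n\<close> is regular, and \<open>a \<mapsto> n - a\<close> is an involution of the other regular
  residues, so that these have average \<open>n / 2\<close>.\<close>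

lemma regular_mod_diff:
  assumes "regular_mod n a"
  shows "regular_mod n (n - a)"
proof -
  obtain x where "n dvd a\<^sup>2 * x - a"
    using assms by (auto simp: regular_mod_def cong_iff_dvd_diff)
  \<comment> \<open>As \<open>n - a\<close> is congruent to \<open>-a\<close>, the witness
    \<open>x\<close> becomes \<open>-x\<close>.\<close>
  moreover have "(n - a)\<^sup>2 * (- x) - (n - a) = n * (2 * a * x - n * x - 1) - (a\<^sup>2 * x - a)"
    by (simp add: power2_eq_square algebra_simps)
  ultimately have "n dvd (n - a)\<^sup>2 * (- x) - (n - a)"
    by (metis dvd_diff dvd_triv_left)
  then show ?thesis
    unfolding regular_mod_def cong_iff_dvd_diff by blast
qed

lemma finite_Reg: "finite (Reg n)"
  by (rule finite_subset[of _ "{1..n}"]) (auto simp: Reg_def)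

lemma self_mem_Reg:
  assumes "n \<ge> 1"
  shows "n \<in> Reg n"
  using assms by (auto simp: Reg_def regular_mod_def cong_iff_dvd_diff power2_eq_square)

lemma sum_Reg_minus_self:
  "2 * (\<Sum>a\<in>Reg n - {n}. a) = n * int (card (Reg n - {n}))"
proof -
  let ?R = "Reg n - {n}"
  have "(\<Sum>a\<in>?R. a) = (\<Sum>a\<in>?R. n - a)"
    \<comment> \<open>Excluding \<open>n\<close> is essential: its reflection \<open>0\<close> lies
      outside \<open>Reg n\<close>, while \<open>1..n-1\<close> is mapped to itself.\<close>
    by (rule sum.reindex_bij_witness[of _ "\<lambda>a. n - a" "\<lambda>a. n - a"])
       (auto simp: Reg_def regular_mod_diff)
  then show ?thesis
    by (simp add: sum_subtractf mult.commute)
qed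

theorem theorem3:
  fixes n :: int
  assumes "n \<ge> 1"
  shows "real_of_int (reg_sum n) = real_of_int n * (real (varrho n) + 1) / 2"
proof -
  have "reg_sum n = n + (\<Sum>a\<in>Reg n - {n}. a)"
    unfolding reg_sum_def using sum.remove[OF finite_Reg self_mem_Reg[OF assms]] .
  moreover have "varrho n = Suc (card (Reg n - {n}))"
    unfolding varrho_def using card.remove[OF finite_Reg self_mem_Reg[OF assms]] .
  \<comment> \<open>With \<open>k\<close> the size of \<open>Reg n - {n}\<close>:
    \<open>2 * n + n * k = n * ((k + 1) + 1)\<close>.\<close>
  ultimately have "2 * reg_sum n = n * (int (varrho n) + 1)"
    using sum_Reg_minus_self[of n] by (simp add: algebra_simps)
  then have "real_of_int (2 * reg_sum n) = real_of_int (n * (int (varrho n) + 1))"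
    by (rule arg_cong)
  then show ?thesis
    by simp
qed

end
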